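(* Let $0<q<2$. There exists a constant $C>0$ such that, for any integer $d\ge1$, and any $r,\sigma>0$, we have $$\sup_{\theta\in B_q(r)} \mathbf E_\theta\big(\hat Q_q - Q(\theta)\big)^2 \le C\,\psi^Q_{\sigma,q}(r,d).$$
   Context: Model: one observes $y_j=\theta_j+\sigma\xi_j$, $j=1,\dots,d$, where $\theta=(\theta_1,\dots,\theta_d)\in\mathbb R^d$ is an unknown vector of parameters, $\xi_j$ are i.i.d. standard normal random variables and $\sigma>0$ is the noise level. $\mathbf P_\theta$ is the probability measure of the vector of observations $(y_1,\dots,y_d)$ and $\mathbf E_\theta$ the corresponding expectation. $Q(\theta)=\sum_{i=1}^d\theta_i^2$; $\|\theta\|_q=\big(\sum_{i=1}^d|\theta_i|^q\big)^{1/q}$; $B_q(r)=\{\theta\in\mathbb R^d:\|\theta\|_q\le r\}$. For any $r,\sigma,q>0$ and any integer $d\ge1$, the integer $m$ is defined by $$m=\max\{s\ge 1:\ \sigma^2\log(1+d/s^2)\le r^2s^{-2/q},\ s\in\mathbb N\}$$ if the set $\{s\ge 1:\ \sigma^2\log(1+d/s^2)\le r^2s^{-2/q},\ s\in\mathbb N\}$ is non-empty, and $m=0$ if this set is empty. The rate is $$\psi^Q_{\sigma,q}(r,d)=\begin{cases}\max\{\sigma^2r^2,\sigma^4d\}&\text{if } m>\sqrt d,\\ \max\{\sigma^2r^2,\sigma^4m^2\log^2(1+d/m^2)\}&\text{if } 1\le m\le\sqrt d,\\ r^4&\text{if } m=0.\end{cases}$$ The estimator is $$\hat Q_q=\begin{cases}\sum_{j=1}^d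 y_j^2-d\sigma^2&\text{if } m>\sqrt d,\\ \sum_{j=1}^d(y_j^2-\tilde\alpha_m\sigma^2)\,\mathbf 1_{\{|y_j|>2\sigma\sqrt{2\log(1+d/m^2)}\}}&\text{if } 1\le m\le\sqrt d,\\ 0&\text{if } m=0,\end{cases}$$ where $\tilde\alpha_m=\mathbf E\big(X^2\mid X^2>8\log(1+d/m^2)\big)$, $X\sim\mathcal N(0,1)$, and $\mathbf 1_{\{\cdot\}}$ denotes the indicator function.
   Formalization: The set defining m is infinite for 1<q<2 (and for q=1 when r² ≥ σ²d), so its maximum does not exist there; in those cases m is read as infinity, so that the case m > √d applies. *)

theory Defs
  imports "HOL-Probability.Probability"
begin

text \<open>Vectors in \<open>\<real>\<^sup>d\<close>, with \<open>d\<close> varying, are the extensional functions on \<open>{1..d}\<close>; these are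
  also the points of the product space \<open>\<Pi>\<^sub>M j\<in>{1..d}. borel\<close>.\<close>

definition std_normal :: "real measure" where
  "std_normal = density lborel (\<lambda>x. ennreal (std_normal_density x))"

definition obs_measure :: "nat \<Rightarrow> real \<Rightarrow> (nat \<Rightarrow> real) \<Rightarrow> (nat \<Rightarrow> real) measure" where
  "obs_measure d \<sigma> \<theta> =
     distr (\<Pi>\<^sub>M j\<in>{1..d}. std_normal) (\<Pi>\<^sub>M j\<in>{1..d}. borel)
       (\<lambda>\<xi>. \<lambda>j\<in>{1..d}. \<theta> j + \<sigma> * \<xi> j)"

definition quad :: "nat \<Rightarrow> (nat \<Rightarrow> real) \<Rightarrow> real" where
  "quad d \<theta> = (\<Sum>i=1..d. (\<theta> i)\<^sup>2)"

definition lq_norm :: "nat \<Rightarrow> real \<Rightarrow> (nat \<Rightarrow> real) \<Rightarrow> real" where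
  "lq_norm d q \<theta> = (\<Sum>i=1..d. \<bar>\<theta> i\<bar> powr q) powr (1 / q)"

definition lq_ball :: "nat \<Rightarrow> real \<Rightarrow> real \<Rightarrow> (nat \<Rightarrow> real) set" where
  "lq_ball d q r = {\<theta> \<in> {1..d} \<rightarrow>\<^sub>E UNIV. lq_norm d q \<theta> \<le> r}"

definition m_set :: "nat \<Rightarrow> real \<Rightarrow> real \<Rightarrow> real \<Rightarrow> nat set" where
  "m_set d q r \<sigma> =
     {s. s \<ge> 1 \<and> \<sigma>\<^sup>2 * ln (1 + real d / (real s)\<^sup>2) \<le> r\<^sup>2 * real s powr (- 2 / q)}"

text \<open>For \<open>q > 1\<close>, and for \<open>q = 1\<close> with \<open>r\<^sup>2 \<ge> \<sigma>\<^sup>2 d\<close>, the set above contains all large \<open>s\<close> and has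
  no maximum in \<open>\<nat>\<close>; its maximum is then read as \<open>\<infinity>\<close>, so that \<open>m > sqrt d\<close>.\<close>

definition m_val :: "nat \<Rightarrow> real \<Rightarrow> real \<Rightarrow> real \<Rightarrow> enat" where
  "m_val d q r \<sigma> =
     (if m_set d q r \<sigma> = {} then 0
      else if finite (m_set d q r \<sigma>) then enat (Max (m_set d q r \<sigma>))
      else \<infinity>)"

definition log_term :: "nat \<Rightarrow> enat \<Rightarrow> real" where
  "log_term d m = ln (1 + real d / (real (the_enat m))\<^sup>2)"

definition rate :: "nat \<Rightarrow> real \<Rightarrow> real \<Rightarrow> real \<Rightarrow> real" where
  "rate d q r \<sigma> =
     (let m = m_val d q r \<sigma> in
      if ereal_of_enat m > ereal (sqrt (real d)) then max (\<sigma>\<^sup>2 * r\<^sup>2) (\<sigma> ^ 4 * real d)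
      else if m \<ge> 1 then max (\<sigma>\<^sup>2 * r\<^sup>2) (\<sigma> ^ 4 * (real (the_enat m))\<^sup>2 * (log_term d m)\<^sup>2)
      else r ^ 4)"

text \<open>\<open>\<E>(X\<^sup>2 | X\<^sup>2 > 8 log (1 + d / m\<^sup>2))\<close>: conditioning on an event of positive probability is
  \<^const>\<open>uniform_measure\<close>.\<close>

definition alpha_tilde :: "nat \<Rightarrow> enat \<Rightarrow> real" where
  "alpha_tilde d m =
     (\<integral>x. x\<^sup>2 \<partial>(uniform_measure std_normal {x. x\<^sup>2 > 8 * log_term d m}))"

definition Q_hat :: "nat \<Rightarrow> real \<Rightarrow> real \<Rightarrow> real \<Rightarrow> (nat \<Rightarrow> real) \<Rightarrow> real" where
  "Q_hat d q r \<sigma> y =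
     (let m = m_val d q r \<sigma> in
      if ereal_of_enat m > ereal (sqrt (real d)) then (\<Sum>j=1..d. (y j)\<^sup>2) - real d * \<sigma>\<^sup>2
      else if m \<ge> 1 then
        (\<Sum>j=1..d. ((y j)\<^sup>2 - alpha_tilde d m * \<sigma>\<^sup>2)
                     * of_bool (\<bar>y j\<bar> > 2 * \<sigma> * sqrt (2 * log_term d m)))
      else 0)"

end

theory Submission imports Defs begin

text \<open>Write \<open>L = ln (1 + d / m\<^sup>2)\<close> and rescale to \<open>\<sigma> = 1\<close>. In the sparse case \<open>1 \<le> m \<le> sqrt d\<close>
  the error is a sum of independent terms, one per coordinate, and it suffices to show that the
  error at a coordinate with mean \<open>t\<close> has expectation of order \<open>min (t\<^sup>2) L\<close> and second moment of order
  \<open>t\<^sup>2 + L * min (t\<^sup>2) L + exp (- L)\<close>. Indeed \<open>min (t\<^sup>2) L \<le> \<bar>t\<bar> powr q * L powr (1 - q / 2)\<close> and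
  the maximality of \<open>m\<close> bound the sum of the \<open>min (t\<^sup>2) L\<close> by \<open>(m + 1) * L\<close>, while
  \<open>d * exp (- L) \<le> m\<^sup>2\<close>.

  For \<open>t\<^sup>2 > L / 2\<close> the coordinatewise bounds are crude. For \<open>t\<^sup>2 \<le> L / 2\<close> a change of measure turns
  the shift by \<open>t\<close> into the weight \<open>exp (t * X - t\<^sup>2 / 2)\<close>. The centering \<open>\<alpha>\<close> and evenness kill the terms
  of order 0 and 1 of \<open>exp (t * X)\<close>; as \<open>\<bar>t * X\<bar> \<le> X\<^sup>2 / 4\<close> beyond the threshold, the remainder is
  \<open>t\<^sup>2\<close> times the finite moment \<open>\<E>(X ^ 4 * exp (X\<^sup>2 / 4))\<close>.\<close>

subsection \<open>Gaussian integrals\<close>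

lemma prob_space_std_normal: "prob_space std_normal"
  unfolding std_normal_def by (rule prob_space_normal_density) simp

lemma sets_std_normal [simp, measurable_cong]: "sets std_normal = sets borel"
  and space_std_normal [simp]: "space std_normal = UNIV"
  by (simp_all add: std_normal_def)

lemma measure_std_normal_UNIV [simp]: "measure std_normal UNIV = 1"
  using prob_space.prob_space[OF prob_space_std_normal] by simp

lemma integrable_std_normal_iff:
  fixes f :: "real \<Rightarrow> real"
  assumes "f \<in> borel_measurable borel"
  shows "integrable std_normal f \<longleftrightarrow> integrable lborel (\<lambda>x. std_normal_density x * f x)"
  unfolding std_normal_def using assms by (subst integrable_density) (auto simp: less_imp_le)

lemma integral_std_normal:
  fixes f :: "real \<Rightarrow> real"
  assumes "f \<in> borel_measurable borel"
  shows "integral\<^sup>L std_normal f = (\<integral>x. std_normal_density x * f x \<partial>lborel)"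
  unfolding std_normal_def using assms by (subst integral_density) (auto simp: less_imp_le)

lemma integrable_std_normal_power [simp]: "integrable std_normal (\<lambda>x. x ^ k)"
  using integrable_std_normal_moment[of k] by (simp add: integrable_std_normal_iff)

lemma integrable_std_normal_id [simp]: "integrable std_normal (\<lambda>x. x)"
  using integrable_std_normal_power[of 1] by simp

lemma expectation_std_normal:
  "(\<integral>x. x \<partial>std_normal) = 0"
  "(\<integral>x. x\<^sup>2 \<partial>std_normal) = 1"
  "(\<integral>x. x ^ 4 \<partial>std_normal) = 3"
  using integral_std_normal_moment_odd[of 0] integral_std_normal_moment_even[of 1]
    integral_std_normal_moment_even[of 2]
  by (simp_all add: integral_std_normal fact_numeral power_numeral_reduce)

text \<open>The weight lowers the exponent from \<open>x\<^sup>2 / 2\<close> to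
  \<open>x\<^sup>2 / 4\<close>, which leaves a multiple of the centered normal density of variance
  2. All polynomial moments with this weight are therefore finite.\<close>

lemma std_normal_density_exp_quarter:
  "std_normal_density x * exp (x\<^sup>2 / 4) = sqrt 2 * normal_density 0 (sqrt 2) x"
proof -
  have "- x\<^sup>2 / 2 + x\<^sup>2 / 4 = - x\<^sup>2 / 4" by simp
  then have "exp (- x\<^sup>2 / 2) * exp (x\<^sup>2 / 4) = exp (- x\<^sup>2 / 4)" by (metis exp_add)
  moreover have "sqrt (2 * pi * 2) = sqrt (2 * pi) * sqrt 2" by (simp add: real_sqrt_mult)
  ultimately show ?thesis
    by (simp add: normal_density_def real_sqrt_mult field_simps)
qed

lemma integrable_std_normal_power_exp:
  "integrable std_normal (\<lambda>x. x ^ k * exp (x\<^sup>2 / 4))"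
proof -
  have "integrable lborel (\<lambda>x. sqrt 2 * (normal_density 0 (sqrt 2) x * (x - 0) ^ k))"
    by (intro integrable_mult_right integrable_normal_moment) simp
  also have "(\<lambda>x. sqrt 2 * (normal_density 0 (sqrt 2) x * (x - 0) ^ k))
      = (\<lambda>x. std_normal_density x * (x ^ k * exp (x\<^sup>2 / 4)))"
    using std_normal_density_exp_quarter by (auto simp: fun_eq_iff algebra_simps)
  finally show ?thesis by (simp add: integrable_std_normal_iff)
qed

text \<open>Cameron-Martin formula: substitute \<open>x - t\<close> for \<open>x\<close> and expand
  the square in the density. The mean \<open>t\<close> then appears only in the smooth weight
  \<open>exp (t * x)\<close>, while the discontinuous threshold function stays fixed.\<close>

lemma integral_std_normal_shift:
  fixes g :: "real \<Rightarrow> real"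
  assumes [measurable]: "g \<in> borel_measurable borel"
  shows "(\<integral>x. g (t + x) \<partial>std_normal) = exp (- t\<^sup>2 / 2) * (\<integral>x. g x * exp (t * x) \<partial>std_normal)"
proof -
  have "(\<integral>x. g (t + x) \<partial>std_normal) = (\<integral>x. std_normal_density x * g (t + x) \<partial>lborel)"
    by (rule integral_std_normal) measurable
  also have "\<dots> = (\<integral>x. std_normal_density (- t + x) * g (t + (- t + x)) \<partial>lborel)"
    using lborel_integral_real_affine[of 1 "\<lambda>x. std_normal_density x * g (t + x)" "- t"] by simp
  also have "\<dots> = (\<integral>x. exp (- t\<^sup>2 / 2) * (std_normal_density x * (g x * exp (t * x))) \<partial>lborel)"
  proof (rule Bochner_Integration.integral_cong[OF refl])
    fix x
    have "- (- t + x)\<^sup>2 / 2 = - t\<^sup>2 / 2 + (- x\<^sup>2 / 2 + t * x)"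
      by (simp add: power2_eq_square field_simps)
    then have "exp (- (- t + x)\<^sup>2 / 2) = exp (- t\<^sup>2 / 2) * (exp (- x\<^sup>2 / 2) * exp (t * x))"
      by (simp only: exp_add)
    then show "std_normal_density (- t + x) * g (t + (- t + x))
        = exp (- t\<^sup>2 / 2) * (std_normal_density x * (g x * exp (t * x)))"
      by (simp add: std_normal_density_def)
  qed
  also have "\<dots> = exp (- t\<^sup>2 / 2) * (\<integral>x. g x * exp (t * x) \<partial>std_normal)"
    by (simp add: integral_std_normal)
  finally show ?thesis .
qed

text \<open>Reflection \<open>x \<mapsto> - x\<close> shows that the integral equals its own
  negative. It removes the first-order term of \<open>exp (t * x)\<close> against the even function
  \<open>thresh L\<close>.\<close>

lemma integral_std_normal_odd:
  fixes g :: "real \<Rightarrow> real"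
  assumes [measurable]: "g \<in> borel_measurable borel" and "\<And>x. g (- x) = - g x"
  shows "(\<integral>x. g x \<partial>std_normal) = 0"
proof -
  have "(\<integral>x. std_normal_density x * g x \<partial>lborel) = (\<integral>x. std_normal_density (- x) * g (- x) \<partial>lborel)"
    using lborel_integral_real_affine[of "-1" "\<lambda>x. std_normal_density x * g x" 0] by simp
  also have "\<dots> = - (\<integral>x. std_normal_density x * g x \<partial>lborel)"
    by (simp add: assms(2) std_normal_density_def)
  finally show ?thesis by (simp add: integral_std_normal)
qed

text \<open>Expand the square into a double sum. By independence an off-diagonal term integrates to
  a product of two means, and the diagonal gives the second moments. Passing to absolute values and
  adding the nonnegative squares of the means on the diagonal completes the square of the sum of
  absolute means.\<close>

lemma
  fixes N :: "real measure" and f :: "'i \<Rightarrow> real \<Rightarrow> real"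
  assumes N: "prob_space N" and I: "finite I"
    and f: "\<And>i. i \<in> I \<Longrightarrow> integrable N (f i)"
    and f2: "\<And>i. i \<in> I \<Longrightarrow> integrable N (\<lambda>x. (f i x)\<^sup>2)"
  shows integrable_sum_coordinates_power2:
      "integrable (\<Pi>\<^sub>M i\<in>I. N) (\<lambda>x. (\<Sum>i\<in>I. f i (x i))\<^sup>2)"
    and integral_sum_coordinates_power2_le:
      "(\<integral>x. (\<Sum>i\<in>I. f i (x i))\<^sup>2 \<partial>(\<Pi>\<^sub>M i\<in>I. N))
        \<le> (\<Sum>i\<in>I. \<bar>\<integral>x. f i x \<partial>N\<bar>)\<^sup>2 + (\<Sum>i\<in>I. \<integral>x. (f i x)\<^sup>2 \<partial>N)"
proof -
  interpret N: prob_space N by (rule N)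
  interpret P: product_sigma_finite "\<lambda>i. N" by unfold_locales
  \<comment> \<open>Writes \<open>f i (x i) * f j (x j)\<close> as a product over all of
    \<open>I\<close>, with factor 1 at the other coordinates, so that the product integral theorem
    applies. For \<open>i = j\<close> both factors fall on the same coordinate and give the
    square.\<close>
  define h where "h i j k x = (if k = i then f i x else 1) * (if k = j then f j x else 1)" for i j k x
  have prod_h: "(\<Prod>k\<in>I. h i j k (x k)) = f i (x i) * f j (x j)" if "i \<in> I" "j \<in> I" for i j x
    using that I by (simp add: h_def prod.distrib)
  have int_h: "integrable N (h i j k)" if "i \<in> I" "j \<in> I" for i j k
    using f[OF that(1)] f[OF that(2)] f2[OF that(1)]
    by (cases "k = i"; cases "k = j") (auto simp: h_def[abs_def] power2_eq_square)
  have int: "integrable (\<Pi>\<^sub>M i\<in>I. N) (\<lambda>x. f i (x i) * f j (x j))" if "i \<in> I" "j \<in> I" for i j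
    using P.product_integrable_prod[OF I, of "h i j"] int_h that by (simp add: prod_h)
  have val: "(\<integral>x. f i (x i) * f j (x j) \<partial>(\<Pi>\<^sub>M i\<in>I. N))
      = (if i = j then \<integral>x. (f i x)\<^sup>2 \<partial>N else (\<integral>x. f i x \<partial>N) * (\<integral>x. f j x \<partial>N))"
    if "i \<in> I" "j \<in> I" for i j
  proof -
    have "(\<integral>x. f i (x i) * f j (x j) \<partial>(\<Pi>\<^sub>M i\<in>I. N)) = (\<Prod>k\<in>I. \<integral>x. h i j k x \<partial>N)"
      using P.product_integral_prod[OF I, of "h i j"] int_h that by (simp add: prod_h)
    also have "\<dots> = (\<Prod>k\<in>I. if i = j then (if k = i then \<integral>x. (f i x)\<^sup>2 \<partial>N else 1)
        else (if k = i then \<integral>x. f i x \<partial>N else 1) * (if k = j then \<integral>x. f j x \<partial>N else 1))"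
      by (intro prod.cong) (auto simp: h_def power2_eq_square N.prob_space)
    also have "\<dots> = (if i = j then \<integral>x. (f i x)\<^sup>2 \<partial>N else (\<integral>x. f i x \<partial>N) * (\<integral>x. f j x \<partial>N))"
      using that I by (simp add: prod.distrib)
    finally show ?thesis .
  qed
  have eq: "(\<lambda>x. (\<Sum>i\<in>I. f i (x i))\<^sup>2) = (\<lambda>x. \<Sum>i\<in>I. \<Sum>j\<in>I. f i (x i) * f j (x j))"
    by (simp add: power2_eq_square sum_product)
  show "integrable (\<Pi>\<^sub>M i\<in>I. N) (\<lambda>x. (\<Sum>i\<in>I. f i (x i))\<^sup>2)"
    unfolding eq by (intro Bochner_Integration.integrable_sum int)
  let ?a = "\<lambda>i. \<integral>x. f i x \<partial>N"
  have "(\<integral>x. (\<Sum>i\<in>I. f i (x i))\<^sup>2 \<partial>(\<Pi>\<^sub>M i\<in>I. N))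
      = (\<Sum>i\<in>I. \<Sum>j\<in>I. if i = j then \<integral>x. (f i x)\<^sup>2 \<partial>N else ?a i * ?a j)"
    unfolding eq
    by (simp add: Bochner_Integration.integral_sum Bochner_Integration.integrable_sum int val
        cong: sum.cong)
  also have "\<dots> \<le> (\<Sum>i\<in>I. \<Sum>j\<in>I. \<bar>?a i\<bar> * \<bar>?a j\<bar> + (if i = j then \<integral>x. (f i x)\<^sup>2 \<partial>N else 0))"
    by (intro sum_mono) (auto simp flip: abs_mult)
  also have "\<dots> = (\<Sum>i\<in>I. \<bar>?a i\<bar>)\<^sup>2 + (\<Sum>i\<in>I. \<integral>x. (f i x)\<^sup>2 \<partial>N)"
    using I by (simp add: sum.distrib power2_eq_square sum_product)
  finally show "(\<integral>x. (\<Sum>i\<in>I. f i (x i))\<^sup>2 \<partial>(\<Pi>\<^sub>M i\<in>I. N))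
      \<le> (\<Sum>i\<in>I. \<bar>?a i\<bar>)\<^sup>2 + (\<Sum>i\<in>I. \<integral>x. (f i x)\<^sup>2 \<partial>N)" .
qed

subsection \<open>The centering constant and the thresholded square\<close>

text \<open>This is \<open>alpha_tilde\<close> with the logarithm replaced by a free real
  \<open>L\<close>, so that bounds can be uniform in \<open>L\<close>.\<close>

definition cond_second_moment :: "real \<Rightarrow> real" where
  "cond_second_moment L = (\<integral>x. x\<^sup>2 \<partial>(uniform_measure std_normal {x. x\<^sup>2 > 8 * L}))"

text \<open>With \<open>\<tau> = sqrt (8 * L)\<close>, only the unit interval just beyond
  \<open>\<tau>\<close> is kept; there \<open>x\<^sup>2\<close> is at most
  \<open>(\<tau> + 1)\<^sup>2 \<le> 16 * L + 2\<close>. The rate \<open>exp (- 8 * L)\<close> is not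
  sharp, but it is what the comparison in \<open>cond_second_moment_le\<close> requires.\<close>

lemma std_normal_tail_ge:
  assumes "0 \<le> L"
  shows "exp (- 1 - 8 * L) / sqrt (2 * pi) \<le> measure std_normal {x. x\<^sup>2 > 8 * L}"
proof -
  interpret prob_space std_normal by (rule prob_space_std_normal)
  define \<tau> where "\<tau> = sqrt (8 * L)"
  have \<tau>: "0 \<le> \<tau>" "\<tau>\<^sup>2 = 8 * L" using assms by (auto simp: \<tau>_def)
  let ?c = "exp (- 1 - 8 * L) / sqrt (2 * pi)"
  have "?c = (\<integral>x. ?c * indicator {\<tau><..\<tau> + 1} x \<partial>lborel)" by simp
  also have "\<dots> \<le> (\<integral>x. std_normal_density x * indicator {\<tau><..\<tau> + 1} x \<partial>lborel)"
  proof (rule integral_mono)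
    show "integrable lborel (\<lambda>x. ?c * indicator {\<tau><..\<tau> + 1} x)"
      by (intro integrable_mult_right integrable_real_indicator) (auto simp: emeasure_lborel_Ioc)
    show "integrable lborel (\<lambda>x. std_normal_density x * indicator {\<tau><..\<tau> + 1} x)"
      by (intro integrable_real_mult_indicator) auto
    show "?c * indicator {\<tau><..\<tau> + 1} x \<le> std_normal_density x * indicator {\<tau><..\<tau> + 1} x" for x
    proof (cases "x \<in> {\<tau><..\<tau> + 1}")
      case True
      then have "x\<^sup>2 \<le> (\<tau> + 1)\<^sup>2" using \<tau> by (intro power_mono) auto
      also have "\<dots> \<le> 2 * \<tau>\<^sup>2 + 2" using zero_le_power2[of "\<tau> - 1"]
        by (simp add: power2_eq_square algebra_simps)
      finally have "- 1 - 8 * L \<le> - x\<^sup>2 / 2" using \<tau> by simp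
      then show ?thesis using True by (simp add: std_normal_density_def divide_right_mono)
    qed simp
  qed
  also have "\<dots> = measure std_normal {\<tau><..\<tau> + 1}"
    using integral_std_normal[of "indicator {\<tau><..\<tau> + 1}"] by simp
  also have "\<dots> \<le> measure std_normal {x. x\<^sup>2 > 8 * L}"
  proof (rule finite_measure_mono)
    show "{\<tau><..\<tau> + 1} \<subseteq> {x. x\<^sup>2 > 8 * L}"
      using \<tau> by (auto simp flip: \<tau>(2) intro!: power_strict_mono)
  qed simp
  finally show ?thesis .
qed

text \<open>The tail bound makes the conditioning probability \<open>p\<close> positive, so the
  conditioned measure has density \<open>indicator ?A x / p\<close>; multiplying by \<open>p\<close>
  leaves a truncated moment.\<close>

lemma cond_second_moment_eq:
  assumes "0 \<le> L"
  shows "cond_second_moment L * measure std_normal {x. x\<^sup>2 > 8 * L}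
    = (\<integral>x. x\<^sup>2 * of_bool (8 * L < x\<^sup>2) \<partial>std_normal)"
proof -
  interpret prob_space std_normal by (rule prob_space_std_normal)
  let ?A = "{x::real. x\<^sup>2 > 8 * L}"
  define p where "p = measure std_normal ?A"
  have "0 < exp (- 1 - 8 * L) / sqrt (2 * pi)" by simp
  then have p: "0 < p" using std_normal_tail_ge[OF assms] unfolding p_def by linarith
  have A[measurable]: "?A \<in> sets borel" by measurable
  have "uniform_measure std_normal ?A = density std_normal (\<lambda>x. ennreal (indicator ?A x / p))"
    unfolding uniform_measure_def emeasure_eq_measure p_def[symmetric]
    using p by (auto simp: divide_ennreal[symmetric] ennreal_indicator)
  then have "cond_second_moment L = (\<integral>x. (indicator ?A x / p) *\<^sub>R x\<^sup>2 \<partial>std_normal)"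
    unfolding cond_second_moment_def using p
    by (simp only:) (rule integral_density, auto)
  also have "\<dots> = (\<integral>x. x\<^sup>2 * of_bool (8 * L < x\<^sup>2) / p \<partial>std_normal)"
    by (intro Bochner_Integration.integral_cong) (auto simp: indicator_def)
  finally show ?thesis using p by (simp add: p_def)
qed

lemma cond_second_moment_nonneg: "0 \<le> cond_second_moment L"
  unfolding cond_second_moment_def by simp

lemma half_le_ln_2: "1 / 2 \<le> ln (2::real)"
  using exp_half_le2 by (subst ln_ge_iff) auto

text \<open>The centering is of the order of the squared threshold, with a constant independent of
  \<open>L\<close>. This is what later bounds the centered square by a multiple of
  \<open>x\<^sup>2\<close>.\<close>

lemma cond_second_moment_le:
  "\<exists>K\<ge>1. \<forall>L\<ge>ln 2. cond_second_moment L \<le> K * (8 * L)"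
proof -
  interpret prob_space std_normal by (rule prob_space_std_normal)
  define M where "M = (\<integral>x. x\<^sup>2 * exp (x\<^sup>2 / 4) \<partial>std_normal)"
  have M: "0 \<le> M" by (simp add: M_def)
  \<comment> \<open>The 4 comes from the cutoff, \<open>32 * L = 4 * (8 * L)\<close>. The second
    summand is the contribution beyond the cutoff, multiplied by
    \<open>8 * L \<ge> 1\<close>.\<close>
  define K where "K = 4 + M * (sqrt (2 * pi) * exp 1)"
  have "cond_second_moment L \<le> K * (8 * L)" if L: "ln 2 \<le> L" for L
  proof -
    define p where "p = measure std_normal {x. x\<^sup>2 > 8 * L}"
    have L2: "1 / 2 \<le> L" using L half_le_ln_2 by linarith
    have lower: "exp (- 1 - 8 * L) / sqrt (2 * pi) \<le> p"
      unfolding p_def using L2 by (intro std_normal_tail_ge) simp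
    have "0 < exp (- 1 - 8 * L) / sqrt (2 * pi)" by simp
    then have p: "0 < p" using lower by linarith
    have A[measurable]: "{x::real. x\<^sup>2 > 8 * L} \<in> sets borel" by measurable
    have int: "integrable std_normal (\<lambda>x. indicator {x. x\<^sup>2 > 8 * L} x :: real)"
      by (intro integrable_real_indicator) (auto simp: less_top[symmetric])
    have "cond_second_moment L * p = (\<integral>x. x\<^sup>2 * of_bool (8 * L < x\<^sup>2) \<partial>std_normal)"
      unfolding p_def using L2 by (intro cond_second_moment_eq) simp
    \<comment> \<open>Beyond \<open>x\<^sup>2 = 32 * L\<close> the contribution is of order \<open>exp (- 8 * L)\<close>, which by
      the lower tail bound is at most a multiple of the conditioning probability.\<close>
    also have "\<dots> \<le> (\<integral>x. 32 * L * indicator {x. x\<^sup>2 > 8 * L} x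
        + exp (- 8 * L) * (x\<^sup>2 * exp (x\<^sup>2 / 4)) \<partial>std_normal)"
    proof (rule integral_mono)
      show "integrable std_normal (\<lambda>x. x\<^sup>2 * of_bool (8 * L < x\<^sup>2))"
        by (rule Bochner_Integration.integrable_bound[OF integrable_std_normal_power[of 2]]) auto
      show "integrable std_normal (\<lambda>x. 32 * L * indicator {x. x\<^sup>2 > 8 * L} x
          + exp (- 8 * L) * (x\<^sup>2 * exp (x\<^sup>2 / 4)))"
        by (intro Bochner_Integration.integrable_add integrable_mult_right
            integrable_std_normal_power_exp int)
      show "x\<^sup>2 * of_bool (8 * L < x\<^sup>2) \<le> 32 * L * indicator {x. x\<^sup>2 > 8 * L} x
          + exp (- 8 * L) * (x\<^sup>2 * exp (x\<^sup>2 / 4))" for x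
      proof (cases "x\<^sup>2 \<le> 32 * L")
        case True
        then show ?thesis using L2 by (auto simp: indicator_def intro!: add_increasing2)
      next
        case False
        then have "1 \<le> exp (- 8 * L + x\<^sup>2 / 4)" by simp
        then have "x\<^sup>2 * 1 \<le> x\<^sup>2 * (exp (- 8 * L) * exp (x\<^sup>2 / 4))"
          unfolding exp_add[symmetric] by (intro mult_left_mono) auto
        moreover have "x\<^sup>2 * of_bool (8 * L < x\<^sup>2) \<le> x\<^sup>2" by simp
        moreover have "0 \<le> 32 * L * (indicator {x. x\<^sup>2 > 8 * L} x :: real)" using L2 by simp
        ultimately show ?thesis by (simp add: algebra_simps)
      qed
    qed
    also have "\<dots> = 32 * L * p + exp (- 8 * L) * M"
      unfolding M_def p_def
      by (subst Bochner_Integration.integral_add)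
        (auto intro!: integrable_mult_right integrable_std_normal_power_exp int simp: Int_def)
    also have "\<dots> \<le> 32 * L * p + M * (sqrt (2 * pi) * exp 1) * p"
    proof -
      have "exp (- 8 * L) = (exp (- 1 - 8 * L) / sqrt (2 * pi)) * (sqrt (2 * pi) * exp 1)"
        by (simp add: exp_diff exp_minus field_simps)
      also have "\<dots> \<le> p * (sqrt (2 * pi) * exp 1)"
        using lower by (intro mult_right_mono) auto
      finally show ?thesis using M by (simp add: mult_left_mono algebra_simps)
    qed
    also have "\<dots> \<le> K * (8 * L) * p"
    proof -
      have "M * (sqrt (2 * pi) * exp 1) * 1 \<le> M * (sqrt (2 * pi) * exp 1) * (8 * L)"
        using L2 M by (intro mult_left_mono) auto
      then have "32 * L + M * (sqrt (2 * pi) * exp 1) \<le> K * (8 * L)"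
        by (simp add: K_def algebra_simps)
      then show ?thesis using p mult_right_mono[of _ _ p] by (fastforce simp: algebra_simps)
    qed
    finally show ?thesis using p by simp
  qed
  moreover have "1 \<le> K" using M by (simp add: K_def add_increasing2)
  ultimately show ?thesis by blast
qed

text \<open>One summand of the sparse estimator at noise level 1, with the threshold condition
  squared.\<close>

definition thresh :: "real \<Rightarrow> real \<Rightarrow> real" where
  "thresh L x = (x\<^sup>2 - cond_second_moment L) * of_bool (8 * L < x\<^sup>2)"

lemma measurable_thresh [measurable]: "thresh L \<in> borel_measurable borel"
  unfolding thresh_def by measurable

text \<open>The centering constant is chosen for this purpose: a coordinate with mean 0 contributes
  no bias, and the zeroth-order term in \<open>t\<close> vanishes.\<close>

lemma expectation_thresh:
  assumes "0 \<le> L"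
  shows "(\<integral>x. thresh L x \<partial>std_normal) = 0"
proof -
  interpret prob_space std_normal by (rule prob_space_std_normal)
  have A[measurable]: "{x::real. x\<^sup>2 > 8 * L} \<in> sets borel" by measurable
  have int: "integrable std_normal (\<lambda>x. indicator {x. x\<^sup>2 > 8 * L} x :: real)"
    by (intro integrable_real_indicator) (auto simp: less_top[symmetric])
  have "(\<integral>x. thresh L x \<partial>std_normal) = (\<integral>x. x\<^sup>2 * of_bool (8 * L < x\<^sup>2)
      - cond_second_moment L * indicator {x. x\<^sup>2 > 8 * L} x \<partial>std_normal)"
    by (intro Bochner_Integration.integral_cong) (auto simp: thresh_def indicator_def)
  also have "\<dots> = 0"
    by (subst Bochner_Integration.integral_diff)
      (auto intro!: Bochner_Integration.integrable_bound[OF integrable_std_normal_power[of 2]]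
        integrable_mult_right int simp: cond_second_moment_eq[OF assms, symmetric] Int_def)
  finally show ?thesis .
qed

text \<open>Beyond the threshold, \<open>x\<^sup>2\<close> and the centering both lie between 0 and
  \<open>K * x\<^sup>2\<close>, and hence so does the absolute value of their difference.\<close>

lemma abs_thresh_le:
  assumes "cond_second_moment L \<le> K * (8 * L)" "1 \<le> K"
  shows "\<bar>thresh L x\<bar> \<le> K * x\<^sup>2 * of_bool (8 * L < x\<^sup>2)"
proof (cases "8 * L < x\<^sup>2")
  case True
  have "K * (8 * L) \<le> K * x\<^sup>2" using True assms by (intro mult_left_mono) auto
  moreover have "1 * x\<^sup>2 \<le> K * x\<^sup>2" using assms by (intro mult_right_mono) auto
  moreover have "thresh L x = x\<^sup>2 - cond_second_moment L" using True by (simp add: thresh_def)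
  ultimately have "\<bar>thresh L x\<bar> \<le> K * x\<^sup>2"
    using assms(1) cond_second_moment_nonneg[of L] zero_le_power2[of x] by linarith
  then show ?thesis using True by simp
qed (simp add: thresh_def)

section \<open>Square integrability of the error at one coordinate\<close>

lemma power2_add_le: "(a + b)\<^sup>2 \<le> 2 * a\<^sup>2 + 2 * (b\<^sup>2 :: real)"
  using zero_le_power2[of "a - b"] by (simp add: power2_eq_square algebra_simps)

lemma power4_add_le: "(a + b) ^ 4 \<le> 8 * a ^ 4 + 8 * (b ^ 4 :: real)"
proof -
  have "((a + b)\<^sup>2)\<^sup>2 \<le> (2 * a\<^sup>2 + 2 * b\<^sup>2)\<^sup>2" by (intro power_mono power2_add_le) auto
  also have "\<dots> \<le> 2 * (2 * a\<^sup>2)\<^sup>2 + 2 * (2 * b\<^sup>2)\<^sup>2" by (rule power2_add_le)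
  finally show ?thesis by (simp add: power_mult_distrib)
qed

lemma integrable_thresh_error_power2:
  assumes "cond_second_moment L \<le> K * (8 * L)" "1 \<le> K"
  shows "integrable std_normal (\<lambda>x. (thresh L (t + x) - t\<^sup>2)\<^sup>2)"
proof (rule Bochner_Integration.integrable_bound)
  interpret prob_space std_normal by (rule prob_space_std_normal)
  show "integrable std_normal (\<lambda>x. 2 * K\<^sup>2 * (8 * t ^ 4 + 8 * x ^ 4) + 2 * t ^ 4)"
    by simp
  have "(thresh L (t + x) - t\<^sup>2)\<^sup>2 \<le> 2 * K\<^sup>2 * (8 * t ^ 4 + 8 * x ^ 4) + 2 * t ^ 4" for x
  proof -
    have "\<bar>thresh L (t + x)\<bar> \<le> K * (t + x)\<^sup>2"
      using abs_thresh_le[OF assms, of "t + x"] assms by (auto split: if_splits simp: of_bool_def)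
    then have "(thresh L (t + x))\<^sup>2 \<le> (K * (t + x)\<^sup>2)\<^sup>2"
      by (rule abs_le_square_iff[THEN iffD1, OF order_trans]) simp
    also have "\<dots> = K\<^sup>2 * (t + x) ^ 4" by (simp add: power_mult_distrib)
    also have "\<dots> \<le> K\<^sup>2 * (8 * t ^ 4 + 8 * x ^ 4)" by (intro mult_left_mono power4_add_le) simp
    finally show ?thesis
      using power2_add_le[of "thresh L (t + x)" "- t\<^sup>2"] by simp
  qed
  then show "AE x in std_normal. norm ((thresh L (t + x) - t\<^sup>2)\<^sup>2)
      \<le> norm (2 * K\<^sup>2 * (8 * t ^ 4 + 8 * x ^ 4) + 2 * t ^ 4)"
    by (auto simp: abs_of_nonneg)
qed measurable

lemma integrable_thresh_error:
  assumes "cond_second_moment L \<le> K * (8 * L)" "1 \<le> K"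
  shows "integrable std_normal (\<lambda>x. thresh L (t + x) - t\<^sup>2)"
proof -
  interpret prob_space std_normal by (rule prob_space_std_normal)
  show ?thesis
    by (rule square_integrable_imp_integrable[OF _ integrable_thresh_error_power2[OF assms]]) measurable
qed

subsection \<open>The error at one coordinate\<close>

lemma exp_minus_one_minus_le: "\<bar>exp u - 1 - u\<bar> \<le> exp \<bar>u\<bar> * (u::real)\<^sup>2"
  using Taylor_exp_field[of u 1] by (simp add: power2_eq_square algebra_simps)

text \<open>Second-order expansion of the weight \<open>exp (t * x)\<close> after the change of
  measure. The smallness of \<open>t\<close> keeps the weight below
  \<open>exp (x\<^sup>2 / 4)\<close> wherever \<open>thresh L\<close> is nonzero.\<close>

lemma thresh_bias_small:
  assumes K: "cond_second_moment L \<le> K * (8 * L)" "1 \<le> K"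
    and L: "0 \<le> L" and t: "t\<^sup>2 \<le> L / 2"
  shows "\<bar>\<integral>x. thresh L (t + x) \<partial>std_normal\<bar>
    \<le> K * (\<integral>x. x ^ 4 * exp (x\<^sup>2 / 4) \<partial>std_normal) * t\<^sup>2"
proof -
  \<comment> \<open>The two conditions give
    \<open>t\<^sup>2 \<le> L / 2 < x\<^sup>2 / 16\<close>.\<close>
  have tx: "\<bar>t * x\<bar> \<le> x\<^sup>2 / 4" if "8 * L < x\<^sup>2" for x
  proof (rule power2_le_imp_le)
    have "t\<^sup>2 * x\<^sup>2 \<le> (x\<^sup>2 / 16) * x\<^sup>2"
      using that t by (intro mult_right_mono) auto
    then show "\<bar>t * x\<bar>\<^sup>2 \<le> (x\<^sup>2 / 4)\<^sup>2"
      by (simp add: power_mult_distrib power_divide)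
  qed simp
  \<comment> \<open>This one domination gives the integrability of both products below, since
    \<open>exp (t * x)\<close> and \<open>\<bar>t * x\<bar>\<close> are at most
    \<open>exp \<bar>t * x\<bar>\<close>, and it also bounds the Taylor remainder.\<close>
  have bnd: "\<bar>thresh L x\<bar> * exp \<bar>t * x\<bar> \<le> K * (x\<^sup>2 * exp (x\<^sup>2 / 4))" for x
  proof (cases "8 * L < x\<^sup>2")
    case True
    then have "\<bar>thresh L x\<bar> * exp \<bar>t * x\<bar> \<le> (K * x\<^sup>2) * exp (x\<^sup>2 / 4)"
      using abs_thresh_le[OF K, of x] tx[OF True] K by (intro mult_mono) auto
    then show ?thesis by (simp add: algebra_simps)
  next
    case False
    then show ?thesis using K by (simp add: thresh_def)
  qed
  have int2: "integrable std_normal (\<lambda>x. K * (x\<^sup>2 * exp (x\<^sup>2 / 4)))"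
    and int4: "integrable std_normal (\<lambda>x. K * t\<^sup>2 * (x ^ 4 * exp (x\<^sup>2 / 4)))"
    by (intro integrable_mult_right integrable_std_normal_power_exp)+
  have i0: "integrable std_normal (thresh L)"
    using integrable_thresh_error[OF K, of 0] by simp
  have i1: "integrable std_normal (\<lambda>x. thresh L x * exp (t * x))"
  proof (rule Bochner_Integration.integrable_bound[OF int2])
    have "\<bar>thresh L x\<bar> * exp (t * x) \<le> K * (x\<^sup>2 * exp (x\<^sup>2 / 4))" for x
      by (rule order_trans[OF mult_left_mono bnd]) auto
    then show "AE x in std_normal. norm (thresh L x * exp (t * x)) \<le> norm (K * (x\<^sup>2 * exp (x\<^sup>2 / 4)))"
      using K by (auto simp: abs_mult)
  qed measurable
  have i2: "integrable std_normal (\<lambda>x. thresh L x * (t * x))"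
  proof (rule Bochner_Integration.integrable_bound[OF int2])
    have "\<bar>thresh L x\<bar> * \<bar>t * x\<bar> \<le> K * (x\<^sup>2 * exp (x\<^sup>2 / 4))" for x
      by (rule order_trans[OF mult_left_mono bnd]) (auto intro: order_trans[OF _ exp_ge_add_one_self])
    then show "AE x in std_normal. norm (thresh L x * (t * x)) \<le> norm (K * (x\<^sup>2 * exp (x\<^sup>2 / 4)))"
      using K by (auto simp: abs_mult)
  qed measurable
  have odd: "(\<integral>x. thresh L x * (t * x) \<partial>std_normal) = 0"
    by (rule integral_std_normal_odd) (auto simp: thresh_def)
  have "(\<integral>x. thresh L x * exp (t * x) \<partial>std_normal)
      = (\<integral>x. thresh L x * (exp (t * x) - 1 - t * x) \<partial>std_normal)"
    using i0 i1 i2 expectation_thresh[OF L] odd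
    by (simp add: right_diff_distrib)
  also have "\<bar>\<dots>\<bar> \<le> (\<integral>x. K * t\<^sup>2 * (x ^ 4 * exp (x\<^sup>2 / 4)) \<partial>std_normal)"
  proof (rule order_trans[OF integral_abs_bound], rule integral_mono[OF integrable_abs int4])
    show "integrable std_normal (\<lambda>x. thresh L x * (exp (t * x) - 1 - t * x))"
      using i0 i1 i2 by (simp add: right_diff_distrib)
    show "\<bar>thresh L x * (exp (t * x) - 1 - t * x)\<bar> \<le> K * t\<^sup>2 * (x ^ 4 * exp (x\<^sup>2 / 4))" for x
    proof -
      have "\<bar>thresh L x * (exp (t * x) - 1 - t * x)\<bar> \<le> \<bar>thresh L x\<bar> * (exp \<bar>t * x\<bar> * (t * x)\<^sup>2)"
        unfolding abs_mult[of "thresh L x"] by (intro mult_left_mono exp_minus_one_minus_le) simp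
      also have "\<dots> = (\<bar>thresh L x\<bar> * exp \<bar>t * x\<bar>) * (t * x)\<^sup>2" by simp
      also have "\<dots> \<le> K * (x\<^sup>2 * exp (x\<^sup>2 / 4)) * (t * x)\<^sup>2"
        by (intro mult_right_mono bnd) simp
      also have "\<dots> = K * t\<^sup>2 * (x ^ 4 * exp (x\<^sup>2 / 4))"
        by (simp add: power_mult_distrib power4_eq_xxxx power2_eq_square)
      finally show ?thesis .
    qed
  qed
  finally have "\<bar>\<integral>x. thresh L x * exp (t * x) \<partial>std_normal\<bar>
    \<le> K * (\<integral>x. x ^ 4 * exp (x\<^sup>2 / 4) \<partial>std_normal) * t\<^sup>2"
    by (simp add: algebra_simps)
  \<comment> \<open>The prefactor \<open>exp (- t\<^sup>2 / 2)\<close> of the change of measure is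
    at most 1.\<close>
  moreover have "\<bar>\<integral>x. thresh L (t + x) \<partial>std_normal\<bar>
      \<le> 1 * \<bar>\<integral>x. thresh L x * exp (t * x) \<partial>std_normal\<bar>"
    unfolding integral_std_normal_shift[OF measurable_thresh] abs_mult
    by (intro mult_right_mono) auto
  ultimately show ?thesis by simp
qed

text \<open>A small mean cannot reach the threshold without the noise: if \<open>t + x\<close>
  passes it, then \<open>x\<^sup>2 \<ge> 4 * L\<close>. On that event
  \<open>exp (x\<^sup>2 / 4 - L) \<ge> 1\<close>, which supplies the factor
  \<open>exp (- L)\<close>.\<close>

lemma thresh_power2_small:
  assumes K: "cond_second_moment L \<le> K * (8 * L)" "1 \<le> K"
    and t: "t\<^sup>2 \<le> L / 2"
  shows "(thresh L (t + x))\<^sup>2 \<le> 4 * K\<^sup>2 * exp (- L) * (x ^ 4 * exp (x\<^sup>2 / 4))"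
proof (cases "8 * L < (t + x)\<^sup>2")
  case True
  \<comment> \<open>The weights 4 and 4/3 come from \<open>(3 * t - x)\<^sup>2 \<ge> 0\<close>.
    Since \<open>4 * t\<^sup>2 \<le> 2 * L\<close>, most of the \<open>8 * L\<close> must come from
    \<open>x\<close>.\<close>
  have "(t + x)\<^sup>2 \<le> 4 * t\<^sup>2 + 4 / 3 * x\<^sup>2"
    using zero_le_power2[of "3 * t - x"] by (simp add: power2_eq_square algebra_simps)
  then have y: "(t + x)\<^sup>2 \<le> 2 * x\<^sup>2" and x: "4 * L \<le> x\<^sup>2"
    using True t zero_le_power2[of x] by linarith+
  have "\<bar>thresh L (t + x)\<bar> \<le> K * (t + x)\<^sup>2"
    using abs_thresh_le[OF K, of "t + x"] True by simp
  also have "\<dots> \<le> K * (2 * x\<^sup>2)" using y K by (intro mult_left_mono) auto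
  finally have "(thresh L (t + x))\<^sup>2 \<le> (K * (2 * x\<^sup>2))\<^sup>2"
    using K by (subst abs_le_square_iff[symmetric]) simp
  also have "\<dots> = 4 * K\<^sup>2 * x ^ 4 * 1" by (simp add: power_mult_distrib)
  also have "\<dots> \<le> 4 * K\<^sup>2 * x ^ 4 * (exp (- L) * exp (x\<^sup>2 / 4))"
    unfolding exp_add[symmetric] using x by (intro mult_left_mono) auto
  finally show ?thesis by (simp add: algebra_simps)
next
  case False
  then show ?thesis by (simp add: thresh_def)
qed

text \<open>Compare with the unthresholded square \<open>(t + X)\<^sup>2\<close>. The difference is
  the centering if the coordinate is kept, and a square of at most \<open>8 * L\<close> if it is
  dropped. What remains, \<open>2 * t * X + X\<^sup>2\<close>, has explicit moments.\<close>

lemma thresh_error_large: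
  assumes K: "cond_second_moment L \<le> K * (8 * L)" "1 \<le> K"
    and L: "1 / 2 \<le> L"
  shows "\<bar>\<integral>x. thresh L (t + x) - t\<^sup>2 \<partial>std_normal\<bar> \<le> (2 + 8 * K) * L" (is ?bias)
    and "(\<integral>x. (thresh L (t + x) - t\<^sup>2)\<^sup>2 \<partial>std_normal) \<le> 12 * t\<^sup>2 + (36 + 192 * K\<^sup>2) * L\<^sup>2" (is ?mse)
proof -
  interpret prob_space std_normal by (rule prob_space_std_normal)
  define h where "h x = thresh L (t + x) - (t + x)\<^sup>2" for x
  have decomp: "thresh L (t + x) - t\<^sup>2 = 2 * t * x + x\<^sup>2 + h x" for x
    by (simp add: h_def power2_eq_square algebra_simps)
  have h: "\<bar>h x\<bar> \<le> 8 * K * L" for x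
  proof (cases "8 * L < (t + x)\<^sup>2")
    case True
    then show ?thesis using K cond_second_moment_nonneg[of L] by (simp add: h_def thresh_def)
  next
    case False
    have "1 * (8 * L) \<le> K * (8 * L)" using K L by (intro mult_right_mono) auto
    then show ?thesis using False by (simp add: h_def thresh_def)
  qed
  have [measurable]: "h \<in> borel_measurable borel" unfolding h_def by measurable
  have int_h: "integrable std_normal h"
    by (rule integrable_const_bound[of _ "8 * K * L"]) (use h in auto)
  have "(\<integral>x. thresh L (t + x) - t\<^sup>2 \<partial>std_normal) = 1 + (\<integral>x. h x \<partial>std_normal)"
    unfolding decomp using int_h by (simp add: expectation_std_normal)
  moreover have "\<bar>\<integral>x. h x \<partial>std_normal\<bar> \<le> (\<integral>x. 8 * K * L \<partial>std_normal)"
    by (rule order_trans[OF integral_abs_bound], rule integral_mono) (use int_h h in auto)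
  ultimately show ?bias using L by (simp add: algebra_simps)
  have "(\<integral>x. (thresh L (t + x) - t\<^sup>2)\<^sup>2 \<partial>std_normal)
      \<le> (\<integral>x. 3 * (4 * t\<^sup>2 * x\<^sup>2 + x ^ 4 + (8 * K * L)\<^sup>2) \<partial>std_normal)"
  proof (rule integral_mono[OF integrable_thresh_error_power2[OF K]])
    show "(thresh L (t + x) - t\<^sup>2)\<^sup>2 \<le> 3 * (4 * t\<^sup>2 * x\<^sup>2 + x ^ 4 + (8 * K * L)\<^sup>2)" for x
    proof -
      have three: "(a + b + c)\<^sup>2 \<le> 3 * (a\<^sup>2 + b\<^sup>2 + c\<^sup>2)" for a b c :: real
        using zero_le_power2[of "a - b"] zero_le_power2[of "b - c"] zero_le_power2[of "a - c"]
        by (simp add: power2_eq_square algebra_simps)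
      have "(h x)\<^sup>2 \<le> (8 * K * L)\<^sup>2"
        using h[of x] by (intro power2_le_iff_abs_le[THEN iffD2]) auto
      then show ?thesis
        unfolding decomp using three[of "2 * t * x" "x\<^sup>2" "h x"]
        by (simp add: power_mult_distrib)
    qed
  qed simp
  also have "\<dots> = 12 * t\<^sup>2 + 9 + 192 * K\<^sup>2 * L\<^sup>2"
    by (simp add: expectation_std_normal power_mult_distrib prob_space)
  \<comment> \<open>The 9 is three times the fourth moment of the noise;
    \<open>L \<ge> 1 / 2\<close> turns it into \<open>36 * L\<^sup>2\<close>.\<close>
  also have "\<dots> \<le> 12 * t\<^sup>2 + (36 + 192 * K\<^sup>2) * L\<^sup>2"
  proof -
    have "(1 / 2)\<^sup>2 \<le> L\<^sup>2" using L by (intro power_mono) auto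
    then show ?thesis by (simp add: power_divide algebra_simps)
  qed
  finally show ?mse .
qed

text \<open>Joins the two regimes at \<open>t\<^sup>2 = L / 2\<close>. Below it
  \<open>min (t\<^sup>2) L\<close> is \<open>t\<^sup>2\<close> and the expansion in \<open>t\<close>
  applies; above it the minimum is comparable to \<open>L\<close> and the crude bounds
  suffice.\<close>

lemma thresh_error_bounds:
  "\<exists>K>0. \<forall>L\<ge>ln 2. \<forall>t. integrable std_normal (\<lambda>x. thresh L (t + x) - t\<^sup>2)
    \<and> integrable std_normal (\<lambda>x. (thresh L (t + x) - t\<^sup>2)\<^sup>2)
    \<and> \<bar>\<integral>x. thresh L (t + x) - t\<^sup>2 \<partial>std_normal\<bar> \<le> K * min (t\<^sup>2) L
    \<and> (\<integral>x. (thresh L (t + x) - t\<^sup>2)\<^sup>2 \<partial>std_normal) \<le> K * (t\<^sup>2 + L * min (t\<^sup>2) L + exp (- L))"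
proof -
  interpret prob_space std_normal by (rule prob_space_std_normal)
  obtain K where K1: "1 \<le> K" and K: "\<And>L. ln 2 \<le> L \<Longrightarrow> cond_second_moment L \<le> K * (8 * L)"
    using cond_second_moment_le by blast
  define M where "M = (\<integral>x. x ^ 4 * exp (x\<^sup>2 / 4) \<partial>std_normal)"
  have M: "0 \<le> M" by (simp add: M_def)
  define a b where "a = K * M" and "b = 8 * K\<^sup>2 * M"
  have nonneg: "0 \<le> a" "0 \<le> b" "0 \<le> K\<^sup>2" using K1 M by (auto simp: a_def b_def)
  \<comment> \<open>The sum of all constants needed in the two regimes, hence an upper bound for
    each. The doubled ones belong to large \<open>t\<close> and come from
    \<open>L \<le> 2 * min (t\<^sup>2) L\<close>.\<close>
  define K' where "K' = a + 1 + 2 * (2 + 8 * K) + 12 + 2 * (36 + 192 * K\<^sup>2) + b"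
  have "a + 1 \<le> K'" "2 * (2 + 8 * K) \<le> K'" "12 \<le> K'"
    "2 * (36 + 192 * K\<^sup>2) \<le> K'" "b \<le> K'" "2 \<le> K'"
    using nonneg K1 unfolding K'_def by auto
  moreover from this have "0 < K'" by linarith
  ultimately have K': "0 < K'" "K * M + 1 \<le> K'" "2 * (2 + 8 * K) \<le> K'" "12 \<le> K'"
    "2 * (36 + 192 * K\<^sup>2) \<le> K'" "8 * K\<^sup>2 * M \<le> K'" "2 \<le> K'"
    unfolding a_def b_def by blast+
  have "\<bar>\<integral>x. thresh L (t + x) - t\<^sup>2 \<partial>std_normal\<bar> \<le> K' * min (t\<^sup>2) L
    \<and> (\<integral>x. (thresh L (t + x) - t\<^sup>2)\<^sup>2 \<partial>std_normal) \<le> K' * (t\<^sup>2 + L * min (t\<^sup>2) L + exp (- L))"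
    if L: "ln 2 \<le> L" for L t
  proof -
    note K = K[OF L] K1
    have L2: "1 / 2 \<le> L" using L half_le_ln_2 by linarith
    show ?thesis
    proof (cases "t\<^sup>2 \<le> L / 2")
      case True
      then have m: "min (t\<^sup>2) L = t\<^sup>2" using L2 by auto
      have int: "integrable std_normal (\<lambda>x. thresh L (t + x))"
        using Bochner_Integration.integrable_add[OF integrable_thresh_error[OF K, of t], of "\<lambda>x. t\<^sup>2"]
        by simp
      have "(\<integral>x. thresh L (t + x) - t\<^sup>2 \<partial>std_normal) = (\<integral>x. thresh L (t + x) \<partial>std_normal) - t\<^sup>2"
        using int by (simp add: prob_space)
      moreover have "\<bar>\<integral>x. thresh L (t + x) \<partial>std_normal\<bar> \<le> K * M * t\<^sup>2"
        unfolding M_def using K L2 True by (intro thresh_bias_small) auto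
      ultimately have "\<bar>\<integral>x. thresh L (t + x) - t\<^sup>2 \<partial>std_normal\<bar> \<le> (K * M + 1) * t\<^sup>2"
        unfolding distrib_right using zero_le_power2[of t] by linarith
      also have "\<dots> \<le> K' * t\<^sup>2" using K' by (intro mult_right_mono) auto
      finally have 1: "\<bar>\<integral>x. thresh L (t + x) - t\<^sup>2 \<partial>std_normal\<bar> \<le> K' * t\<^sup>2" .
      have "(\<integral>x. (thresh L (t + x) - t\<^sup>2)\<^sup>2 \<partial>std_normal)
          \<le> (\<integral>x. 8 * K\<^sup>2 * exp (- L) * (x ^ 4 * exp (x\<^sup>2 / 4)) + 2 * t ^ 4 \<partial>std_normal)"
      proof (rule integral_mono[OF integrable_thresh_error_power2[OF K]])
        show "integrable std_normal (\<lambda>x. 8 * K\<^sup>2 * exp (- L) * (x ^ 4 * exp (x\<^sup>2 / 4)) + 2 * t ^ 4)"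
          by (intro Bochner_Integration.integrable_add integrable_mult_right
              integrable_std_normal_power_exp) simp
        show "(thresh L (t + x) - t\<^sup>2)\<^sup>2
            \<le> 8 * K\<^sup>2 * exp (- L) * (x ^ 4 * exp (x\<^sup>2 / 4)) + 2 * t ^ 4" for x
          using power2_add_le[of "thresh L (t + x)" "- t\<^sup>2"] thresh_power2_small[OF K True, of x]
          by simp
      qed
      also have "\<dots> = 8 * K\<^sup>2 * M * exp (- L) + 2 * t ^ 4"
        unfolding M_def
        by (subst Bochner_Integration.integral_add)
          (auto intro!: integrable_mult_right integrable_std_normal_power_exp simp: prob_space)
      also have "\<dots> \<le> K' * exp (- L) + K' * (L * t\<^sup>2)"
      proof (rule add_mono)
        have "t ^ 4 = t\<^sup>2 * t\<^sup>2" by (simp add: power4_eq_xxxx power2_eq_square)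
        also have "\<dots> \<le> L * t\<^sup>2" using True L2 by (intro mult_right_mono) auto
        finally show "2 * t ^ 4 \<le> K' * (L * t\<^sup>2)" using K' by (intro mult_mono) auto
        show "8 * K\<^sup>2 * M * exp (- L) \<le> K' * exp (- L)" using K' by (intro mult_right_mono) auto
      qed
      also have "\<dots> \<le> K' * (t\<^sup>2 + L * t\<^sup>2 + exp (- L))"
        using K' by (simp add: algebra_simps)
      finally show ?thesis using 1 m by simp
    next
      case False
      define m where "m = min (t\<^sup>2) L"
      have m: "L \<le> 2 * m" using False L2 by (auto simp: m_def)
      have "(2 + 8 * K) * L \<le> (2 + 8 * K) * (2 * m)" using m K by (intro mult_left_mono) auto
      also have "\<dots> = 2 * (2 + 8 * K) * m" by simp
      also have "\<dots> \<le> K' * m" using K' m L2 by (intro mult_right_mono) auto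
      finally have 1: "\<bar>\<integral>x. thresh L (t + x) - t\<^sup>2 \<partial>std_normal\<bar> \<le> K' * m"
        using thresh_error_large(1)[OF K L2, of t] by linarith
      have "(36 + 192 * K\<^sup>2) * L\<^sup>2 \<le> (36 + 192 * K\<^sup>2) * (L * (2 * m))"
        unfolding power2_eq_square using m L2 by (intro mult_left_mono) auto
      also have "\<dots> = 2 * (36 + 192 * K\<^sup>2) * (L * m)" by simp
      also have "\<dots> \<le> K' * (L * m)" using K' m L2 by (intro mult_right_mono) auto
      finally have "(36 + 192 * K\<^sup>2) * L\<^sup>2 \<le> K' * (L * m)" .
      moreover have "12 * t\<^sup>2 \<le> K' * t\<^sup>2" using K' by (intro mult_right_mono) auto
      moreover have "0 \<le> K' * exp (- L)" using K' by simp
      ultimately have "12 * t\<^sup>2 + (36 + 192 * K\<^sup>2) * L\<^sup>2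
          \<le> K' * t\<^sup>2 + K' * (L * m) + K' * exp (- L)"
        by linarith
      then show ?thesis
        using 1 thresh_error_large(2)[OF K L2, of t] unfolding m_def by (simp add: distrib_left)
    qed
  qed
  then show ?thesis
    using K' integrable_thresh_error[OF K K1] integrable_thresh_error_power2[OF K K1]
    by (intro exI[of _ K']) blast
qed

subsection \<open>Norm balls\<close>

lemma sum_powr_le:
  assumes "0 < q" "\<theta> \<in> lq_ball d q r"
  shows "(\<Sum>i=1..d. \<bar>\<theta> i\<bar> powr q) \<le> r powr q"
proof -
  let ?S = "\<Sum>i=1..d. \<bar>\<theta> i\<bar> powr q"
  have "0 \<le> ?S" by (intro sum_nonneg) simp
  then have "?S = (?S powr (1 / q)) powr q" using assms by (simp add: powr_powr)
  also have "\<dots> \<le> r powr q"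
    using assms by (intro powr_mono2) (auto simp: lq_ball_def lq_norm_def)
  finally show ?thesis .
qed

text \<open>Embedding of the \<open>q\<close>-ball into the Euclidean ball: every coordinate is at
  most \<open>r\<close> in absolute value, so \<open>2 - q\<close> of the two powers of
  \<open>\<theta> i\<close> can be traded for powers of \<open>r\<close>.\<close>

lemma quad_le_power2:
  assumes q: "0 < q" "q \<le> 2" and r: "0 < r" and \<theta>: "\<theta> \<in> lq_ball d q r"
  shows "quad d \<theta> \<le> r\<^sup>2"
proof -
  have "(\<theta> i)\<^sup>2 \<le> \<bar>\<theta> i\<bar> powr q * r powr (2 - q)" if i: "i \<in> {1..d}" for i
  proof (cases "\<theta> i = 0")
    case False
    have "\<bar>\<theta> i\<bar> powr q \<le> r powr q"
      by (rule order_trans[OF member_le_sum sum_powr_le[OF q(1) \<theta>]]) (use i in auto)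
    then have le: "\<bar>\<theta> i\<bar> \<le> r"
      using powr_less_mono2[of q r "\<bar>\<theta> i\<bar>"] q r by (cases "\<bar>\<theta> i\<bar> \<le> r") auto
    have "(\<theta> i)\<^sup>2 = \<bar>\<theta> i\<bar> powr (q + (2 - q))" using False by simp
    also have "\<dots> = \<bar>\<theta> i\<bar> powr q * \<bar>\<theta> i\<bar> powr (2 - q)" by (rule powr_add)
    also have "\<dots> \<le> \<bar>\<theta> i\<bar> powr q * r powr (2 - q)"
      using q le by (intro mult_left_mono powr_mono2) auto
    finally show ?thesis .
  qed simp
  then have "quad d \<theta> \<le> (\<Sum>i=1..d. \<bar>\<theta> i\<bar> powr q) * r powr (2 - q)"
    unfolding quad_def sum_distrib_right by (rule sum_mono)
  also have "\<dots> \<le> r powr q * r powr (2 - q)"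
    by (intro mult_right_mono sum_powr_le q \<theta>) simp
  also have "\<dots> = r\<^sup>2" using r by (simp flip: powr_add)
  finally show ?thesis .
qed

text \<open>Split the minimum into its powers \<open>q / 2\<close> and \<open>1 - q / 2\<close>, and
  bound the first by the power of \<open>t\<^sup>2\<close> and the second by the power of
  \<open>L\<close>.\<close>

lemma min_le_powr_mult_powr:
  fixes t L q :: real
  assumes "0 < q" "q \<le> 2" "0 < L"
  shows "min (t\<^sup>2) L \<le> \<bar>t\<bar> powr q * L powr (1 - q / 2)"
proof (cases "t = 0")
  case False
  let ?m = "min (t\<^sup>2) L"
  have m: "0 < ?m" using False assms by simp
  have t2: "(t\<^sup>2) powr (q / 2) = \<bar>t\<bar> powr q"
    using powr_powr[of "\<bar>t\<bar>" 2 "q / 2"] False by simp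
  have "?m = ?m powr (q / 2 + (1 - q / 2))" using m by simp
  also have "\<dots> = ?m powr (q / 2) * ?m powr (1 - q / 2)" by (rule powr_add)
  also have "\<dots> \<le> (t\<^sup>2) powr (q / 2) * L powr (1 - q / 2)"
    using assms m by (intro mult_mono powr_mono2) auto
  finally show ?thesis unfolding t2 .
qed (use assms in auto)

text \<open>The assumption on \<open>s\<close> rearranges to
  \<open>(r / \<sigma>) powr q \<le> s * L powr (q / 2)\<close>, and interpolation bounds the sum by
  \<open>(r / \<sigma>) powr q * L powr (1 - q / 2)\<close>. Keeping \<open>s\<close> separate from
  \<open>L\<close> allows \<open>s = m + 1\<close> with the logarithm taken at
  \<open>m\<close>.\<close>

lemma sum_min_le:
  assumes q: "0 < q" "q \<le> 2" and r: "0 < r" and \<sigma>: "0 < \<sigma>" and L: "0 < L"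
    and s: "0 < s" "r\<^sup>2 * s powr (- 2 / q) \<le> \<sigma>\<^sup>2 * L"
    and \<theta>: "\<theta> \<in> lq_ball d q r"
  shows "(\<Sum>j=1..d. min ((\<theta> j / \<sigma>)\<^sup>2) L) \<le> s * L"
proof -
  have "(r / \<sigma>)\<^sup>2 \<le> s powr (2 / q) * L"
    using s \<sigma> by (simp add: powr_minus power_divide field_simps)
  then have "((r / \<sigma>)\<^sup>2) powr (q / 2) \<le> (s powr (2 / q) * L) powr (q / 2)"
    using q by (intro powr_mono2) auto
  also have "\<dots> = s * L powr (q / 2)" using q s by (simp add: powr_mult powr_powr)
  finally have rs: "(r / \<sigma>) powr q \<le> s * L powr (q / 2)"
    using powr_powr[of "r / \<sigma>" 2 "q / 2"] r \<sigma> by simp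
  have "(\<Sum>j=1..d. min ((\<theta> j / \<sigma>)\<^sup>2) L) \<le> (\<Sum>j=1..d. \<bar>\<theta> j / \<sigma>\<bar> powr q * L powr (1 - q / 2))"
    by (intro sum_mono min_le_powr_mult_powr q L)
  also have "\<dots> = (\<Sum>j=1..d. \<bar>\<theta> j\<bar> powr q) / \<sigma> powr q * L powr (1 - q / 2)"
    using \<sigma> by (simp add: sum_distrib_right sum_divide_distrib powr_divide)
  also have "\<dots> \<le> r powr q / \<sigma> powr q * L powr (1 - q / 2)"
    by (intro mult_right_mono divide_right_mono sum_powr_le q \<theta>) auto
  also have "\<dots> = (r / \<sigma>) powr q * L powr (1 - q / 2)"
    using r \<sigma> by (simp add: powr_divide)
  also have "\<dots> \<le> s * L powr (q / 2) * L powr (1 - q / 2)"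
    by (intro mult_right_mono rs) simp
  also have "\<dots> = s * L" using L by (simp add: mult.assoc flip: powr_add)
  finally show ?thesis .
qed

subsection \<open>Mean square errors\<close>

lemma nn_integral_obs_measure:
  assumes f: "f \<in> borel_measurable (\<Pi>\<^sub>M j\<in>{1..d}. borel)"
  shows "(\<integral>\<^sup>+ y. f y \<partial>(obs_measure d \<sigma> \<theta>))
    = (\<integral>\<^sup>+ \<xi>. f (\<lambda>j\<in>{1..d}. \<theta> j + \<sigma> * \<xi> j) \<partial>(\<Pi>\<^sub>M j\<in>{1..d}. std_normal))"
proof -
  have "(\<lambda>\<xi>. \<lambda>j\<in>{1..d}. \<theta> j + \<sigma> * \<xi> j)
      \<in> measurable (\<Pi>\<^sub>M j\<in>{1..d}. std_normal) (\<Pi>\<^sub>M j\<in>{1..d}. borel)"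
    by (rule measurable_restrict) measurable
  then show ?thesis
    unfolding obs_measure_def by (rule nn_integral_distr) (use f in simp)
qed

text \<open>Common frame for the dense estimator (\<open>s = 1\<close>) and the sparse one
  (\<open>s = \<sigma>\<^sup>2\<close>): in both, the error is a multiple of a sum of functions of
  single noise coordinates.\<close>

lemma mean_square_error_le:
  fixes T :: "(nat \<Rightarrow> real) \<Rightarrow> real"
  assumes T: "T \<in> borel_measurable (\<Pi>\<^sub>M j\<in>{1..d}. borel)"
    and err: "\<And>\<xi>. T (\<lambda>j\<in>{1..d}. \<theta> j + \<sigma> * \<xi> j) - c = s * (\<Sum>j=1..d. f j (\<xi> j))"
    and f: "\<And>j. j \<in> {1..d} \<Longrightarrow> integrable std_normal (f j)"
    and f2: "\<And>j. j \<in> {1..d} \<Longrightarrow> integrable std_normal (\<lambda>x. (f j x)\<^sup>2)"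
  shows "(\<integral>\<^sup>+ y. ennreal ((T y - c)\<^sup>2) \<partial>(obs_measure d \<sigma> \<theta>))
    \<le> ennreal (s\<^sup>2 * ((\<Sum>j=1..d. \<bar>\<integral>x. f j x \<partial>std_normal\<bar>)\<^sup>2 + (\<Sum>j=1..d. \<integral>x. (f j x)\<^sup>2 \<partial>std_normal)))"
proof -
  let ?P = "\<Pi>\<^sub>M j\<in>{1..d}. std_normal"
  have "(\<integral>\<^sup>+ y. ennreal ((T y - c)\<^sup>2) \<partial>(obs_measure d \<sigma> \<theta>))
      = (\<integral>\<^sup>+ \<xi>. ennreal ((s * (\<Sum>j=1..d. f j (\<xi> j)))\<^sup>2) \<partial>?P)"
    unfolding err[symmetric] by (rule nn_integral_obs_measure) (use T in measurable)
  also have "\<dots> = (\<integral>\<^sup>+ \<xi>. ennreal (s\<^sup>2 * (\<Sum>j=1..d. f j (\<xi> j))\<^sup>2) \<partial>?P)"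
    by (simp add: power_mult_distrib)
  also have "\<dots> = ennreal (\<integral>\<xi>. s\<^sup>2 * (\<Sum>j=1..d. f j (\<xi> j))\<^sup>2 \<partial>?P)"
    using integrable_sum_coordinates_power2[OF prob_space_std_normal _ f f2, of "{1..d}"]
    by (intro nn_integral_eq_integral integrable_mult_right) auto
  also have "\<dots> \<le> ennreal (s\<^sup>2 * ((\<Sum>j=1..d. \<bar>\<integral>x. f j x \<partial>std_normal\<bar>)\<^sup>2
      + (\<Sum>j=1..d. \<integral>x. (f j x)\<^sup>2 \<partial>std_normal)))"
    using integral_sum_coordinates_power2_le[OF prob_space_std_normal _ f f2, of "{1..d}"]
    by (intro ennreal_leI) (auto intro!: mult_left_mono)
  finally show ?thesis .
qed

text \<open>The error at a coordinate, \<open>2 * \<sigma> * \<theta> j * x + \<sigma>\<^sup>2 *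
  (x\<^sup>2 - 1)\<close>, has mean 0, so only second moments remain. They sum to at most \<open>8 *
  (\<sigma>\<^sup>2 * r\<^sup>2) + 4 * (\<sigma> ^ 4 * real d)\<close>, whence the 12.\<close>

lemma dense_estimator_mean_square_error:
  assumes \<theta>: "quad d \<theta> \<le> r\<^sup>2"
  shows "(\<integral>\<^sup>+ y. ennreal ((((\<Sum>j=1..d. (y j)\<^sup>2) - real d * \<sigma>\<^sup>2) - quad d \<theta>)\<^sup>2) \<partial>(obs_measure d \<sigma> \<theta>))
    \<le> ennreal (12 * max (\<sigma>\<^sup>2 * r\<^sup>2) (\<sigma> ^ 4 * real d))"
proof -
  interpret prob_space std_normal by (rule prob_space_std_normal)
  define f where "f j x = 2 * \<sigma> * \<theta> j * x + \<sigma>\<^sup>2 * (x\<^sup>2 - 1)" for j x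
  have bound: "(f j x)\<^sup>2 \<le> 8 * \<sigma>\<^sup>2 * (\<theta> j)\<^sup>2 * x\<^sup>2 + 2 * \<sigma> ^ 4 * (x ^ 4 - 2 * x\<^sup>2 + 1)" for j x
  proof -
    have "(f j x)\<^sup>2 \<le> 2 * (2 * \<sigma> * \<theta> j * x)\<^sup>2 + 2 * (\<sigma>\<^sup>2 * (x\<^sup>2 - 1))\<^sup>2"
      unfolding f_def by (rule power2_add_le)
    also have "\<dots> = 8 * \<sigma>\<^sup>2 * (\<theta> j)\<^sup>2 * x\<^sup>2 + 2 * \<sigma> ^ 4 * (x ^ 4 - 2 * x\<^sup>2 + 1)"
      by (simp add: power_mult_distrib power2_diff)
    finally show ?thesis .
  qed
  have int_bound: "integrable std_normal
      (\<lambda>x. 8 * \<sigma>\<^sup>2 * (\<theta> j)\<^sup>2 * x\<^sup>2 + 2 * \<sigma> ^ 4 * (x ^ 4 - 2 * x\<^sup>2 + 1))" for j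
    by simp
  have f: "integrable std_normal (f j)" for j
    unfolding f_def by simp
  have f2: "integrable std_normal (\<lambda>x. (f j x)\<^sup>2)" for j
    by (rule Bochner_Integration.integrable_bound[OF int_bound[of j]])
      (use bound[of j] in \<open>auto simp: f_def intro: order_trans[OF _ abs_ge_self]\<close>)
  have mean: "(\<integral>x. f j x \<partial>std_normal) = 0" for j
    by (simp add: f_def[abs_def] expectation_std_normal)
  have "(\<integral>x. (f j x)\<^sup>2 \<partial>std_normal) \<le> 8 * \<sigma>\<^sup>2 * (\<theta> j)\<^sup>2 + 4 * \<sigma> ^ 4" for j
  proof -
    have "(\<integral>x. (f j x)\<^sup>2 \<partial>std_normal)
        \<le> (\<integral>x. 8 * \<sigma>\<^sup>2 * (\<theta> j)\<^sup>2 * x\<^sup>2 + 2 * \<sigma> ^ 4 * (x ^ 4 - 2 * x\<^sup>2 + 1) \<partial>std_normal)"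
      by (intro integral_mono f2 int_bound bound)
    also have "\<dots> = 8 * \<sigma>\<^sup>2 * (\<theta> j)\<^sup>2 + 4 * \<sigma> ^ 4"
      by (simp add: expectation_std_normal)
    finally show ?thesis .
  qed
  then have "(\<Sum>j=1..d. \<integral>x. (f j x)\<^sup>2 \<partial>std_normal) \<le> (\<Sum>j=1..d. 8 * \<sigma>\<^sup>2 * (\<theta> j)\<^sup>2 + 4 * \<sigma> ^ 4)"
    by (rule sum_mono)
  also have "\<dots> = 8 * (\<sigma>\<^sup>2 * quad d \<theta>) + 4 * (\<sigma> ^ 4 * real d)"
    by (simp add: quad_def sum.distrib sum_distrib_left mult.assoc)
  also have "\<dots> \<le> 8 * (\<sigma>\<^sup>2 * r\<^sup>2) + 4 * (\<sigma> ^ 4 * real d)"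
    using mult_left_mono[OF \<theta>, of "\<sigma>\<^sup>2"] by simp
  also have "\<dots> \<le> 12 * max (\<sigma>\<^sup>2 * r\<^sup>2) (\<sigma> ^ 4 * real d)" by simp
  finally have var: "(\<Sum>j=1..d. \<integral>x. (f j x)\<^sup>2 \<partial>std_normal) \<le> 12 * max (\<sigma>\<^sup>2 * r\<^sup>2) (\<sigma> ^ 4 * real d)" .
  have err: "((\<Sum>j=1..d. ((\<lambda>j\<in>{1..d}. \<theta> j + \<sigma> * \<xi> j) j)\<^sup>2) - real d * \<sigma>\<^sup>2) - quad d \<theta>
      = 1 * (\<Sum>j=1..d. f j (\<xi> j))" for \<xi>
  proof -
    have "(\<Sum>j=1..d. f j (\<xi> j)) = (\<Sum>j=1..d. (\<theta> j + \<sigma> * \<xi> j)\<^sup>2 - \<sigma>\<^sup>2 - (\<theta> j)\<^sup>2)"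
      by (intro sum.cong) (auto simp: f_def power2_eq_square algebra_simps)
    then show ?thesis by (simp add: sum_subtractf quad_def)
  qed
  have "(\<lambda>y. (\<Sum>j=1..d. (y j)\<^sup>2) - real d * \<sigma>\<^sup>2) \<in> borel_measurable (\<Pi>\<^sub>M j\<in>{1..d}. borel)"
    by measurable
  from mean_square_error_le[OF this err f f2] show ?thesis
    by (rule order_trans) (use var in \<open>auto simp: mean intro!: ennreal_leI\<close>)
qed

text \<open>Here \<open>n\<close> stands for \<open>m\<close>; its maximality enters only as the
  failure of the defining inequality at \<open>n + 1\<close>.\<close>

lemma sparse_estimator_mean_square_error:
  assumes "0 < q" "q < 2"
  shows "\<exists>C>0. \<forall>d n r \<sigma> \<theta>. 1 \<le> n \<longrightarrow> real n \<le> sqrt (real d) \<longrightarrow> 0 < r \<longrightarrow> 0 < \<sigma> \<longrightarrow> \<theta> \<in> lq_ball d q r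
    \<longrightarrow> Suc n \<notin> m_set d q r \<sigma>
    \<longrightarrow> (\<integral>\<^sup>+ y. ennreal (((\<Sum>j=1..d. ((y j)\<^sup>2 - alpha_tilde d (enat n) * \<sigma>\<^sup>2)
            * of_bool (\<bar>y j\<bar> > 2 * \<sigma> * sqrt (2 * log_term d (enat n)))) - quad d \<theta>)\<^sup>2) \<partial>(obs_measure d \<sigma> \<theta>))
      \<le> ennreal (C * max (\<sigma>\<^sup>2 * r\<^sup>2) (\<sigma> ^ 4 * (real n)\<^sup>2 * (log_term d (enat n))\<^sup>2))"
proof -
  obtain K where K0: "0 < K" and K: "\<And>L t. ln 2 \<le> L \<Longrightarrow>
      integrable std_normal (\<lambda>x. thresh L (t + x) - t\<^sup>2)
    \<and> integrable std_normal (\<lambda>x. (thresh L (t + x) - t\<^sup>2)\<^sup>2)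
    \<and> \<bar>\<integral>x. thresh L (t + x) - t\<^sup>2 \<partial>std_normal\<bar> \<le> K * min (t\<^sup>2) L
    \<and> (\<integral>x. (thresh L (t + x) - t\<^sup>2)\<^sup>2 \<partial>std_normal) \<le> K * (t\<^sup>2 + L * min (t\<^sup>2) L + exp (- L))"
    using thresh_error_bounds by metis
  have "(\<integral>\<^sup>+ y. ennreal (((\<Sum>j=1..d. ((y j)\<^sup>2 - alpha_tilde d (enat n) * \<sigma>\<^sup>2)
            * of_bool (\<bar>y j\<bar> > 2 * \<sigma> * sqrt (2 * log_term d (enat n)))) - quad d \<theta>)\<^sup>2) \<partial>(obs_measure d \<sigma> \<theta>))
      \<le> ennreal ((4 * K\<^sup>2 + 7 * K) * max (\<sigma>\<^sup>2 * r\<^sup>2) (\<sigma> ^ 4 * (real n)\<^sup>2 * (log_term d (enat n))\<^sup>2))"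
    if n: "1 \<le> n" "real n \<le> sqrt (real d)" and r: "0 < r" and \<sigma>: "0 < \<sigma>"
      and \<theta>: "\<theta> \<in> lq_ball d q r" and max: "Suc n \<notin> m_set d q r \<sigma>" for d n r \<sigma> \<theta>
  proof -
    define L where "L = log_term d (enat n)"
    have L_eq: "L = ln (1 + real d / (real n)\<^sup>2)" by (simp add: L_def log_term_def)
    have "(real n)\<^sup>2 \<le> (sqrt (real d))\<^sup>2" using n by (intro power_mono) auto
    then have dn: "1 \<le> real d / (real n)\<^sup>2" using n by simp
    \<comment> \<open>The sparsity condition \<open>n \<le> sqrt d\<close> puts \<open>L\<close> in
      the range of the one-coordinate bounds.\<close>
    then have L: "ln 2 \<le> L" unfolding L_eq by (subst ln_le_cancel_iff) auto
    then have L2: "1 / 2 \<le> L" using half_le_ln_2 by linarith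
    \<comment> \<open>The inequality is available at \<open>n + 1\<close> only, but the logarithm
      there is at most \<open>L\<close>. The resulting factor \<open>n + 1\<close> becomes
      \<open>2 * n\<close> because \<open>n \<ge> 1\<close>.\<close>
    have "r\<^sup>2 * real (Suc n) powr (- 2 / q) \<le> \<sigma>\<^sup>2 * ln (1 + real d / (real (Suc n))\<^sup>2)"
      using max by (auto simp: m_set_def)
    also have "\<dots> \<le> \<sigma>\<^sup>2 * L"
    proof -
      have "real d / (real (Suc n))\<^sup>2 \<le> real d / (real n)\<^sup>2"
        using n by (intro divide_left_mono power_mono) auto
      moreover have "0 < 1 + real d / (real (Suc n))\<^sup>2" by (intro add_pos_nonneg) auto
      ultimately show ?thesis
        unfolding L_eq by (intro mult_left_mono) (auto intro!: ln_mono)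
    qed
    finally have S: "(\<Sum>j=1..d. min ((\<theta> j / \<sigma>)\<^sup>2) L) \<le> real (Suc n) * L"
      using assms r \<sigma> L2 \<theta> by (intro sum_min_le) auto
    define S where "S = (\<Sum>j=1..d. min ((\<theta> j / \<sigma>)\<^sup>2) L)"
    have S0: "0 \<le> S" unfolding S_def using L2 by (intro sum_nonneg) auto
    have "S \<le> real (Suc n) * L" using S by (simp add: S_def)
    also have "\<dots> \<le> 2 * real n * L" using n L2 by (intro mult_right_mono) auto
    finally have SL: "S \<le> 2 * real n * L" .
    define f where "f j x = thresh L (\<theta> j / \<sigma> + x) - (\<theta> j / \<sigma>)\<^sup>2" for j x
    define V where "V = (real n)\<^sup>2 * L\<^sup>2"
    have bias: "(\<Sum>j=1..d. \<bar>\<integral>x. f j x \<partial>std_normal\<bar>)\<^sup>2 \<le> 4 * K\<^sup>2 * V"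
    proof -
      have "(\<Sum>j=1..d. \<bar>\<integral>x. f j x \<partial>std_normal\<bar>) \<le> (\<Sum>j=1..d. K * min ((\<theta> j / \<sigma>)\<^sup>2) L)"
        unfolding f_def using K[OF L] by (intro sum_mono) blast
      also have "\<dots> = K * S" by (simp add: S_def sum_distrib_left)
      also have "\<dots> \<le> K * (2 * real n * L)" using SL K0 by (intro mult_left_mono) auto
      finally have "(\<Sum>j=1..d. \<bar>\<integral>x. f j x \<partial>std_normal\<bar>)\<^sup>2 \<le> (K * (2 * real n * L))\<^sup>2"
        by (intro power_mono sum_nonneg) auto
      then show ?thesis by (simp add: V_def power_mult_distrib)
    qed
    \<comment> \<open>\<open>exp (- L)\<close> is the reciprocal of
      \<open>1 + d / n\<^sup>2\<close>, so the product is at most \<open>n\<^sup>2\<close>; the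
      factor \<open>4 * L\<^sup>2 \<ge> 1\<close> brings it to the form of \<open>V\<close>.\<close>
    have dexp: "real d * exp (- L) \<le> 4 * V"
    proof -
      have "real d * exp (- L) = real d / (1 + real d / (real n)\<^sup>2)"
        using dn unfolding L_eq by (simp add: exp_minus divide_inverse)
      also have "\<dots> \<le> (real n)\<^sup>2"
        using n dn by (simp add: divide_le_eq algebra_simps add_pos_nonneg)
      also have "\<dots> \<le> (real n)\<^sup>2 * (4 * L\<^sup>2)"
        using power_mono[of "1 / 2" L 2] L2 n by (simp add: power_divide)
      finally show ?thesis by (simp add: V_def)
    qed
    have LS: "L * S \<le> 2 * V"
    proof -
      have "L * S \<le> L * (2 * real n * L)" using SL L2 by (intro mult_left_mono) auto
      also have "\<dots> = real n * (2 * L\<^sup>2)" by (simp add: power2_eq_square)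
      also have "\<dots> \<le> (real n)\<^sup>2 * (2 * L\<^sup>2)"
        using n by (intro mult_right_mono) (auto simp: power2_eq_square)
      finally show ?thesis by (simp add: V_def)
    qed
    have quad: "(\<Sum>j=1..d. (\<theta> j / \<sigma>)\<^sup>2) \<le> r\<^sup>2 / \<sigma>\<^sup>2"
      using quad_le_power2[OF _ _ r \<theta>] assms
      by (simp add: quad_def power_divide divide_right_mono flip: sum_divide_distrib)
    have "(\<Sum>j=1..d. \<integral>x. (f j x)\<^sup>2 \<partial>std_normal)
        \<le> (\<Sum>j=1..d. K * ((\<theta> j / \<sigma>)\<^sup>2 + L * min ((\<theta> j / \<sigma>)\<^sup>2) L + exp (- L)))"
      unfolding f_def using K[OF L] by (intro sum_mono) blast
    also have "\<dots> = K * ((\<Sum>j=1..d. (\<theta> j / \<sigma>)\<^sup>2) + L * S + real d * exp (- L))"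
      by (simp add: S_def sum.distrib flip: sum_distrib_left)
    also have "\<dots> \<le> K * (r\<^sup>2 / \<sigma>\<^sup>2 + 2 * V + 4 * V)"
      using K0 quad LS dexp by (intro mult_left_mono add_mono) auto
    finally have var: "(\<Sum>j=1..d. \<integral>x. (f j x)\<^sup>2 \<partial>std_normal) \<le> K * (r\<^sup>2 / \<sigma>\<^sup>2 + 6 * V)"
      by (simp add: add.commute)
    define R where "R = max (\<sigma>\<^sup>2 * r\<^sup>2) (\<sigma> ^ 4 * (real n)\<^sup>2 * L\<^sup>2)"
    have R: "(\<sigma>\<^sup>2)\<^sup>2 * V \<le> R" "(\<sigma>\<^sup>2)\<^sup>2 * (r\<^sup>2 / \<sigma>\<^sup>2) \<le> R"
      using \<sigma> by (simp_all add: R_def V_def power2_eq_square power4_eq_xxxx mult.assoc)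
    \<comment> \<open>\<open>4 * K\<^sup>2\<close> is the squared bias. Of the \<open>7 * K\<close>,
      two come from \<open>L * S\<close>, four from \<open>d * exp (- L)\<close> and one from the
      Euclidean norm of \<open>\<theta>\<close>.\<close>
    have total: "(\<sigma>\<^sup>2)\<^sup>2 * ((\<Sum>j=1..d. \<bar>\<integral>x. f j x \<partial>std_normal\<bar>)\<^sup>2 + (\<Sum>j=1..d. \<integral>x. (f j x)\<^sup>2 \<partial>std_normal))
        \<le> (4 * K\<^sup>2 + 7 * K) * R"
    proof -
      have "(\<sigma>\<^sup>2)\<^sup>2 * ((\<Sum>j=1..d. \<bar>\<integral>x. f j x \<partial>std_normal\<bar>)\<^sup>2 + (\<Sum>j=1..d. \<integral>x. (f j x)\<^sup>2 \<partial>std_normal))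
          \<le> (\<sigma>\<^sup>2)\<^sup>2 * (4 * K\<^sup>2 * V + K * (r\<^sup>2 / \<sigma>\<^sup>2 + 6 * V))"
        by (intro mult_left_mono add_mono bias var) simp
      also have "\<dots> = (4 * K\<^sup>2 + 6 * K) * ((\<sigma>\<^sup>2)\<^sup>2 * V) + K * ((\<sigma>\<^sup>2)\<^sup>2 * (r\<^sup>2 / \<sigma>\<^sup>2))"
        by (simp only: distrib_left distrib_right mult_ac add_ac)
      also have "\<dots> \<le> (4 * K\<^sup>2 + 6 * K) * R + K * R"
        using K0 by (intro add_mono mult_left_mono R) auto
      finally show ?thesis by (simp add: algebra_simps)
    qed
    \<comment> \<open>Division by \<open>\<sigma>\<close> reduces each coordinate to noise level 1
      with mean \<open>\<theta> j / \<sigma>\<close>; the threshold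
      \<open>2 * \<sigma> * sqrt (2 * L)\<close> becomes \<open>sqrt (8 * L)\<close>.\<close>
    have err: "(\<Sum>j=1..d. (((\<lambda>j\<in>{1..d}. \<theta> j + \<sigma> * \<xi> j) j)\<^sup>2 - alpha_tilde d (enat n) * \<sigma>\<^sup>2)
        * of_bool (\<bar>(\<lambda>j\<in>{1..d}. \<theta> j + \<sigma> * \<xi> j) j\<bar> > 2 * \<sigma> * sqrt (2 * log_term d (enat n)))) - quad d \<theta>
      = \<sigma>\<^sup>2 * (\<Sum>j=1..d. f j (\<xi> j))" for \<xi>
    proof -
      have "((\<theta> j + \<sigma> * \<xi> j)\<^sup>2 - alpha_tilde d (enat n) * \<sigma>\<^sup>2)
          * of_bool (\<bar>\<theta> j + \<sigma> * \<xi> j\<bar> > 2 * \<sigma> * sqrt (2 * log_term d (enat n))) - (\<theta> j)\<^sup>2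
          = \<sigma>\<^sup>2 * f j (\<xi> j)" for j
      proof -
        define z where "z = \<theta> j / \<sigma> + \<xi> j"
        have z: "\<theta> j + \<sigma> * \<xi> j = \<sigma> * z" using \<sigma> by (simp add: z_def distrib_left)
        have "2 * sqrt (2 * L) = sqrt (8 * L)"
          using real_sqrt_mult[of 4 "2 * L"] by simp
        then have "2 * \<sigma> * sqrt (2 * L) = \<sigma> * sqrt (8 * L)" by simp
        then have "\<bar>\<sigma> * z\<bar> > 2 * \<sigma> * sqrt (2 * L) \<longleftrightarrow> sqrt (8 * L) < \<bar>z\<bar>"
          using \<sigma> by (simp add: abs_mult)
        also have "\<dots> \<longleftrightarrow> 8 * L < z\<^sup>2"
          using real_sqrt_less_iff[of "8 * L" "z\<^sup>2"] by simp
        finally have ev: "\<bar>\<sigma> * z\<bar> > 2 * \<sigma> * sqrt (2 * L) \<longleftrightarrow> 8 * L < z\<^sup>2" .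
        have "\<sigma>\<^sup>2 * f j (\<xi> j) = \<sigma>\<^sup>2 * thresh L z - (\<theta> j)\<^sup>2"
          using \<sigma> by (simp add: f_def z_def right_diff_distrib power_divide)
        moreover have "alpha_tilde d (enat n) = cond_second_moment L"
          by (simp add: alpha_tilde_def cond_second_moment_def L_def)
        ultimately show ?thesis
          unfolding z L_def[symmetric] ev thresh_def by (simp add: power_mult_distrib algebra_simps)
      qed
      then show ?thesis
        unfolding quad_def sum_distrib_left sum_subtractf[symmetric]
        by (intro sum.cong refl) (simp only: restrict_apply')
    qed
    have "(\<lambda>y. \<Sum>j=1..d. ((y j)\<^sup>2 - alpha_tilde d (enat n) * \<sigma>\<^sup>2)
        * of_bool (\<bar>y j\<bar> > 2 * \<sigma> * sqrt (2 * log_term d (enat n))))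
      \<in> borel_measurable (\<Pi>\<^sub>M j\<in>{1..d}. borel)"
      by measurable
    from mean_square_error_le[OF this err] show ?thesis
      by (rule order_trans) (use K[OF L] total in \<open>auto simp: f_def R_def L_def intro!: ennreal_leI\<close>)
  qed
  moreover have "0 < 4 * K\<^sup>2 + 7 * K" using K0 by (intro add_nonneg_pos) auto
  ultimately show ?thesis by blast
qed

section \<open>Assembly over the three regimes of the rate\<close>

theorem theorem7:
  fixes q :: real
  assumes "0 < q" and "q < 2"
  shows "\<exists>C::real. C > 0 \<and>
    (\<forall>(d::nat) (r::real) (\<sigma>::real). d \<ge> 1 \<longrightarrow> r > 0 \<longrightarrow> \<sigma> > 0 \<longrightarrow>
      (SUP \<theta>\<in>lq_ball d q r.
         \<integral>\<^sup>+ y. ennreal ((Q_hat d q r \<sigma> y - quad d \<theta>)\<^sup>2) \<partial>(obs_measure d \<sigma> \<theta>))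
      \<le> ennreal (C * rate d q r \<sigma>))"
proof -
  obtain C where C: "0 < C" and sparse_bound: "\<forall>d n r \<sigma> \<theta>. 1 \<le> n \<longrightarrow> real n \<le> sqrt (real d) \<longrightarrow>
      0 < r \<longrightarrow> 0 < \<sigma> \<longrightarrow> \<theta> \<in> lq_ball d q r \<longrightarrow> Suc n \<notin> m_set d q r \<sigma> \<longrightarrow>
      (\<integral>\<^sup>+ y. ennreal (((\<Sum>j=1..d. ((y j)\<^sup>2 - alpha_tilde d (enat n) * \<sigma>\<^sup>2)
            * of_bool (\<bar>y j\<bar> > 2 * \<sigma> * sqrt (2 * log_term d (enat n)))) - quad d \<theta>)\<^sup>2) \<partial>(obs_measure d \<sigma> \<theta>))
      \<le> ennreal (C * max (\<sigma>\<^sup>2 * r\<^sup>2) (\<sigma> ^ 4 * (real n)\<^sup>2 * (log_term d (enat n))\<^sup>2))"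
    using sparse_estimator_mean_square_error[OF assms] by (elim exE conjE) (rule that)
  \<comment> \<open>The constant \<open>C + 12\<close> covers the sparse bound \<open>C\<close>, the
    dense bound 12 and the factor 1 of the case \<open>m = 0\<close>.\<close>
  have "(\<integral>\<^sup>+ y. ennreal ((Q_hat d q r \<sigma> y - quad d \<theta>)\<^sup>2) \<partial>(obs_measure d \<sigma> \<theta>))
      \<le> ennreal ((C + 12) * rate d q r \<sigma>)"
    if r: "0 < r" and \<sigma>: "0 < \<sigma>" and \<theta>: "\<theta> \<in> lq_ball d q r" for d r \<sigma> \<theta>
  proof -
    define m where "m = m_val d q r \<sigma>"
    have quad: "quad d \<theta> \<le> r\<^sup>2" using assms r \<theta> by (intro quad_le_power2) auto
    \<comment> \<open>The value \<open>m = \<infinity>\<close> falls under the dense case.\<close>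
    consider (dense) "ereal_of_enat m > ereal (sqrt (real d))"
      | (sparse) n where "m = enat n" "1 \<le> n" "real n \<le> sqrt (real d)"
      | (zero) "m = 0"
    proof (cases m)
      case (enat n)
      then show ?thesis using that by (cases "n = 0") (force simp: zero_enat_def not_less)+
    qed (use that in auto)
    then show ?thesis
    proof cases
      case dense
      have "12 * max (\<sigma>\<^sup>2 * r\<^sup>2) (\<sigma> ^ 4 * real d) \<le> (C + 12) * max (\<sigma>\<^sup>2 * r\<^sup>2) (\<sigma> ^ 4 * real d)"
        using C by (intro mult_right_mono) (auto intro: max.coboundedI1)
      then show ?thesis
        using dense dense_estimator_mean_square_error[OF quad, of \<sigma>]
        unfolding Q_hat_def rate_def Let_def m_def[symmetric]
        by (auto intro: order_trans ennreal_leI)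
    next
      case (sparse n)
      \<comment> \<open>A finite nonzero \<open>m\<close> excludes both special values in
        \<open>m_val\<close>, so \<open>n\<close> is a genuine maximum and \<open>n + 1\<close> lies
        outside the set.\<close>
      then have fin: "finite (m_set d q r \<sigma>)" "n = Max (m_set d q r \<sigma>)"
        by (auto simp: m_def m_val_def zero_enat_def split: if_splits)
      have "Suc n \<notin> m_set d q r \<sigma>"
        using Max_ge[OF fin(1), of "Suc n"] fin(2) by auto
      note bound = sparse_bound[rule_format, OF sparse(2,3) r \<sigma> \<theta> this]
      have "C * max (\<sigma>\<^sup>2 * r\<^sup>2) (\<sigma> ^ 4 * (real n)\<^sup>2 * (log_term d (enat n))\<^sup>2)
          \<le> (C + 12) * max (\<sigma>\<^sup>2 * r\<^sup>2) (\<sigma> ^ 4 * (real n)\<^sup>2 * (log_term d (enat n))\<^sup>2)"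
        using C by (intro mult_right_mono) (auto intro: max.coboundedI1)
      then show ?thesis
        using bound sparse unfolding Q_hat_def rate_def Let_def m_def[symmetric]
        by (auto simp: one_enat_def intro: order_trans ennreal_leI)
    next
      case zero
      interpret P: prob_space "\<Pi>\<^sub>M j\<in>{1..d}. std_normal"
        by (intro prob_space_PiM prob_space_std_normal)
      have "0 \<le> quad d \<theta>" by (simp add: quad_def sum_nonneg)
      \<comment> \<open>The estimator is 0, so the squared error is the constant
        \<open>(quad d \<theta>)\<^sup>2\<close>, integrated against a probability measure.\<close>
      then have "(quad d \<theta>)\<^sup>2 \<le> (r\<^sup>2)\<^sup>2" using quad by (intro power_mono)
      also have "\<dots> \<le> (C + 12) * r ^ 4"
        using C mult_right_mono[of 1 "C + 12" "r ^ 4"] by simp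
      finally have "(quad d \<theta>)\<^sup>2 \<le> (C + 12) * r ^ 4" .
      moreover have "(\<integral>\<^sup>+ y. ennreal ((quad d \<theta>)\<^sup>2) \<partial>(obs_measure d \<sigma> \<theta>)) = ennreal ((quad d \<theta>)\<^sup>2)"
        by (subst nn_integral_obs_measure) (simp, simp only: nn_integral_const P.emeasure_space_1 mult_1_right)
      ultimately show ?thesis
        using zero unfolding Q_hat_def rate_def Let_def m_def[symmetric]
        by (simp add: ennreal_leI del: nn_integral_const)
    qed
  qed
  then show ?thesis
    using C by (intro exI[of _ "C + 12"]) (auto intro!: SUP_least)
qed

end
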